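(* $\mathsf{ECT}\equiv_{\mathrm W}\mathsf{TC}_{\mathbb N}^*$.
   Context: A Weihrauch problem is a relation $P\subseteq\mathbb N^{\mathbb N}\times\mathbb N$, viewed as a multifunction taking an instance $I\in\mathrm{domain}(P)$ to any solution $S$ with $(I,S)\in P$ (with numbers, pairs and finite sequences coded in the standard computable way where needed). $P\le_{\mathrm W}Q$ means that there are computable functionals $\Phi,\Psi$ such that for all $I\in\mathrm{domain}(P)$, $\Phi(I)\in\mathrm{domain}(Q)$, and for all $S$ with $(\Phi(I),S)\in Q$ we have $(I,\Psi(I,S))\in P$. $P\equiv_{\mathrm W}Q$ means $P\le_{\mathrm W}Q$ and $Q\le_{\mathrm W}P$. $P^*$ is the result of an arbitrary finite number of parallel applications of $P$: an instance is a number $n\in\mathbb N$ together with $n$ instances $I_1,\dots,I_n$ of $P$, and a solution is a (coded) tuple $(S_1,\dots,S_n)$ with each $S_i$ a solution of $I_i$. $\mathsf{TC}_{\mathbb N}$ (total continuation of discrete choice): an instance is an enumeration of the complement of any set $A\subseteq\mathbb N$, empty or not; a solution is a number, which must be an element of $A$ if $A$ is nonempty (if $A=\emptyset$, any number is a solution). Enumerations are given as elements of $\mathbb N^{\mathbb N}$ in the usual way (e.g. $e\in\mathbb N^{\mathbb N}$ enumerates $\{n: \exists s\; e(s)=n+1\}$, the value $0$ giving no information). $\mathsf{ECT}$: an instance is a number $k$ and a function $f:\mathbb N\to k$ (where $k=\{0,\dots,k-1\}$); a solution is any $b\in\mathbb N$ such that for all $x\ge b$ there is a $y>x$ with $f(x)=f(y)$.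 *)

theory Defs
  imports Main "HOL-Library.Nat_Bijection"
begin

section \<open>Partial recursive functionals\<close>

text \<open>
  Kleene's \<open>\<mu>\<close>-recursive functions relative to an oracle in Baire space. Applying a program to
  an argument list too short for it, or of the wrong length for \<open>Succ\<close> and \<open>Oracle\<close>, is undefined.
\<close>

datatype prog =
    Zero
  | Succ
  | Proj nat
  | Oracle
  | Comp prog "prog list"
  | PrimRec prog prog
  | Mu prog

primrec eval :: "prog \<Rightarrow> (nat \<Rightarrow> nat) \<Rightarrow> nat list \<Rightarrow> nat option" where
  "eval Zero f xs = Some 0"
| "eval Succ f xs = (case xs of [x] \<Rightarrow> Some (Suc x) | _ \<Rightarrow> None)"
| "eval (Proj i) f xs = (if i < length xs then Some (xs ! i) else None)"
| "eval Oracle f xs = (case xs of [x] \<Rightarrow> Some (f x) | _ \<Rightarrow> None)"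
| "eval (Comp h gs) f xs =
     Option.bind (those (map (\<lambda>g. eval g f xs) gs)) (\<lambda>ys. eval h f ys)"
| "eval (PrimRec g h) f xs =
     (case xs of
        [] \<Rightarrow> None
      | n # ys \<Rightarrow>
          rec_nat (eval g f ys) (\<lambda>m r. Option.bind r (\<lambda>v. eval h f (m # v # ys))) n)"
| "eval (Mu g) f xs =
     (if \<exists>n. eval g f (n # xs) = Some 0 \<and> (\<forall>m<n. eval g f (m # xs) \<noteq> None)
      then Some (LEAST n. eval g f (n # xs) = Some 0)
      else None)"

text \<open>
  A partial map on Baire space is computable if a single program, with the argument as oracle,
  computes the values of the result. It is defined exactly where the program computes a total
  sequence.
\<close>

definition computable_operator :: "((nat \<Rightarrow> nat) \<Rightarrow> (nat \<Rightarrow> nat) option) \<Rightarrow> bool" where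
  "computable_operator \<Phi> \<longleftrightarrow>
     (\<exists>p. \<forall>I J. \<Phi> I = Some J \<longleftrightarrow> (\<forall>x. eval p I [x] = Some (J x)))"

definition computable_functional :: "((nat \<Rightarrow> nat) \<Rightarrow> nat \<Rightarrow> nat option) \<Rightarrow> bool" where
  "computable_functional \<Psi> \<longleftrightarrow> (\<exists>p. \<forall>I S. \<Psi> I S = eval p I [S])"


section \<open>Weihrauch problems\<close>

type_synonym problem = "((nat \<Rightarrow> nat) \<times> nat) set"

definition weihrauch_le :: "problem \<Rightarrow> problem \<Rightarrow> bool"  (infix "\<le>\<^sub>W" 50) where
  "P \<le>\<^sub>W Q \<longleftrightarrow>
     (\<exists>\<Phi> \<Psi>. computable_operator \<Phi> \<and> computable_functional \<Psi> \<and>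
        (\<forall>I \<in> Domain P. \<exists>J. \<Phi> I = Some J \<and> J \<in> Domain Q \<and>
           (\<forall>S. (J, S) \<in> Q \<longrightarrow> (\<exists>T. \<Psi> I S = Some T \<and> (I, T) \<in> P))))"

definition weihrauch_equiv :: "problem \<Rightarrow> problem \<Rightarrow> bool"  (infix "\<equiv>\<^sub>W" 50) where
  "P \<equiv>\<^sub>W Q \<longleftrightarrow> P \<le>\<^sub>W Q \<and> Q \<le>\<^sub>W P"

text \<open>
  A number \<open>n\<close> with a sequence \<open>f\<close> is coded as the sequence with first value \<open>n\<close> followed by \<open>f\<close>.
  A number \<open>n\<close> with \<open>n\<close> sequences is coded likewise, the \<open>i\<close>-th sequence (\<open>i < n\<close>) being stored at
  the positions \<open>\<langle>i, x\<rangle>\<close> of \<open>f\<close>; the positions \<open>\<langle>i, x\<rangle>\<close> with \<open>i \<ge> n\<close> carry no information.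
\<close>

definition head :: "(nat \<Rightarrow> nat) \<Rightarrow> nat" where
  "head I = I 0"

definition tail :: "(nat \<Rightarrow> nat) \<Rightarrow> nat \<Rightarrow> nat" where
  "tail I = (\<lambda>x. I (Suc x))"

definition component :: "(nat \<Rightarrow> nat) \<Rightarrow> nat \<Rightarrow> nat \<Rightarrow> nat" where
  "component I i = (\<lambda>x. tail I (prod_encode (i, x)))"

definition parallel_star :: "problem \<Rightarrow> problem"  ("_\<^sup>\<star>" [1000] 999) where
  "P\<^sup>\<star> = {(I, S). \<exists>Ss. S = list_encode Ss \<and> length Ss = head I \<and>
                     (\<forall>i < head I. (component I i, Ss ! i) \<in> P)}"

definition enumerated :: "(nat \<Rightarrow> nat) \<Rightarrow> nat set" where
  "enumerated e = {n. \<exists>s. e s = n + 1}"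

definition TC_N :: problem where
  "TC_N = {(e, a). - enumerated e \<noteq> {} \<longrightarrow> a \<in> - enumerated e}"

definition ECT :: problem where
  "ECT = {(I, b). (\<forall>x. tail I x < head I) \<and>
                  (\<forall>x\<ge>b. \<exists>y>x. tail I x = tail I y)}"

end

theory Submission imports Defs "HOL-Library.Infinite_Set" begin

text \<open>
  The reduction of \<open>ECT\<close> uses one instance of \<open>TC_N\<close> per colour \<open>i\<close>, asking for a bound beyond
  which \<open>i\<close> does not occur. Such a bound exists exactly if \<open>i\<close> occurs finitely often, and
  \<open>{b. \<exists>x\<ge>b. f x = i}\<close> is enumerable. Any number above all the answers solves \<open>ECT\<close>: the answers
  for infinitely recurring colours are arbitrary, but such colours violate nothing. The code of a
  list is at least each of its entries, so the coded tuple of answers is itself a solution.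

  For the converse, follow for each enumeration \<open>e\<close> the least number \<open>first_gap e s\<close> not
  enumerated before stage \<open>s\<close>. If the enumerated set is not everything, this guess changes only
  finitely often, and its final value is outside the set. Colour the stage \<open>\<langle>i, s\<rangle>\<close> by \<open>i + 1\<close> if
  the \<open>i\<close>-th guess is refuted at stage \<open>s\<close>, and by \<open>0\<close> otherwise. Beyond an \<open>ECT\<close>-solution \<open>b\<close> only
  colours that recur forever are seen, so a guess that converges has done so by stage \<open>b\<close> (note
  \<open>\<langle>i, s\<rangle> \<ge> s\<close>), and the guesses at stage \<open>b\<close> solve all the instances.

  What remains is that the four maps are given by programs. This follows from closure properties
  of the expressions, with an oracle and finitely many variables, that a program evaluates.
\<close>

section \<open>Expressions evaluated by programs\<close>

text \<open>
  An expression depends on the oracle \<open>f\<close> and an environment \<open>\<rho>\<close> whose first \<open>n\<close> entries are the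
  program's arguments. Environments are functions rather than lists so that entering the scope of
  a binder, which shifts the environment by \<open>\<lambda>i. \<rho> (Suc i)\<close>, turns variables into variables by
  beta reduction alone.
\<close>

definition computable_expr :: "nat \<Rightarrow> ((nat \<Rightarrow> nat) \<Rightarrow> (nat \<Rightarrow> nat) \<Rightarrow> nat) \<Rightarrow> bool" where
  "computable_expr n A \<longleftrightarrow> (\<exists>p. \<forall>f \<rho>. eval p f (map \<rho> [0..<n]) = Some (A f \<rho>))"

abbreviation decidable_expr :: "nat \<Rightarrow> ((nat \<Rightarrow> nat) \<Rightarrow> (nat \<Rightarrow> nat) \<Rightarrow> bool) \<Rightarrow> bool" where
  "decidable_expr n P \<equiv> computable_expr n (\<lambda>f \<rho>. of_bool (P f \<rho>))"

named_theorems computable_intros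

lemma those_map_Some: "those (map Some ys) = Some ys"
  by (induction ys) auto

lemma eval_Comp_total:
  assumes "map (\<lambda>g. eval g f xs) gs = map Some ys"
  shows "eval (Comp h gs) f xs = eval h f ys"
  using assms by (simp add: those_map_Some)

lemma map_env_Suc: "map \<rho> [0..<Suc n] = \<rho> 0 # map (\<lambda>i. \<rho> (Suc i)) [0..<n]"
  unfolding upt_conv_Cons[OF zero_less_Suc] map_Suc_upt[symmetric] by simp

lemma map_env_Cons: "m # map \<rho> [0..<n] = map (case_nat m \<rho>) [0..<Suc n]"
  unfolding map_env_Suc by simp

lemma computable_expr_var [computable_intros]:
  "i < n \<Longrightarrow> computable_expr n (\<lambda>f \<rho>. \<rho> i)"
  unfolding computable_expr_def by (intro exI[of _ "Proj i"]) simp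

lemma computable_expr_zero [computable_intros]: "computable_expr n (\<lambda>f \<rho>. 0)"
  unfolding computable_expr_def by (intro exI[of _ Zero]) simp

lemma computable_expr_Suc [computable_intros]:
  assumes "computable_expr n A"
  shows "computable_expr n (\<lambda>f \<rho>. Suc (A f \<rho>))"
proof -
  obtain p where "\<And>f \<rho>. eval p f (map \<rho> [0..<n]) = Some (A f \<rho>)"
    using assms unfolding computable_expr_def by blast
  then show ?thesis
    unfolding computable_expr_def by (intro exI[of _ "Comp Succ [p]"]) simp
qed

lemma computable_expr_oracle [computable_intros]:
  assumes "computable_expr n A"
  shows "computable_expr n (\<lambda>f \<rho>. f (A f \<rho>))"
proof -
  obtain p where "\<And>f \<rho>. eval p f (map \<rho> [0..<n]) = Some (A f \<rho>)"
    using assms unfolding computable_expr_def by blast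
  then show ?thesis
    unfolding computable_expr_def by (intro exI[of _ "Comp Oracle [p]"]) simp
qed

lemma computable_expr_rec_nat [computable_intros]:
  assumes "computable_expr n G"
    and "computable_expr (Suc (Suc n)) (\<lambda>f \<rho>. H f (\<rho> 0) (\<rho> (Suc 0)) (\<lambda>i. \<rho> (Suc (Suc i))))"
    and "computable_expr n N"
  shows "computable_expr n (\<lambda>f \<rho>. rec_nat (G f \<rho>) (\<lambda>m r. H f m r \<rho>) (N f \<rho>))"
proof -
  obtain g where g: "\<And>f \<rho>. eval g f (map \<rho> [0..<n]) = Some (G f \<rho>)"
    using assms(1) unfolding computable_expr_def by blast
  obtain h where h: "\<And>f \<rho>. eval h f (map \<rho> [0..<Suc (Suc n)]) =
      Some (H f (\<rho> 0) (\<rho> (Suc 0)) (\<lambda>i. \<rho> (Suc (Suc i))))"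
    using assms(2) unfolding computable_expr_def by blast
  obtain p where p: "\<And>f \<rho>. eval p f (map \<rho> [0..<n]) = Some (N f \<rho>)"
    using assms(3) unfolding computable_expr_def by blast
  have h': "eval h f (m # r # map \<rho> [0..<n]) = Some (H f m r \<rho>)" for f m r \<rho>
    using h[of f "case_nat m (case_nat r \<rho>)"] unfolding map_env_Cons by simp
  have rec: "eval (PrimRec g h) f (k # map \<rho> [0..<n]) =
      Some (rec_nat (G f \<rho>) (\<lambda>m r. H f m r \<rho>) k)" for f k \<rho>
    by (induction k) (simp_all add: g h')
  have "eval (Comp (PrimRec g h) (p # map Proj [0..<n])) f (map \<rho> [0..<n]) =
      Some (rec_nat (G f \<rho>) (\<lambda>m r. H f m r \<rho>) (N f \<rho>))" for f \<rho>
    by (subst eval_Comp_total[where ys = "N f \<rho> # map \<rho> [0..<n]"]) (simp_all add: p rec del: eval.simps(6))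
  then show ?thesis
    unfolding computable_expr_def by blast
qed

lemma computable_expr_add [computable_intros]:
  assumes "computable_expr n A" "computable_expr n B"
  shows "computable_expr n (\<lambda>f \<rho>. A f \<rho> + B f \<rho>)"
proof -
  have eq: "a + b = rec_nat a (\<lambda>_ r. Suc r) b" for a b :: nat
    by (induction b) auto
  show ?thesis
    unfolding eq by (intro computable_intros assms) simp
qed

text \<open>
  Case distinction is primitive recursion that ignores the previous value. It serves as the
  conditional of programs. The branch for \<open>0\<close> is evaluated in either case, which is harmless since
  expressions are total.
\<close>

lemma computable_expr_case_nat:
  assumes "computable_expr n C" "computable_expr n A"
    and "computable_expr (Suc (Suc n)) (\<lambda>f \<rho>. B f (\<rho> 0) (\<lambda>i. \<rho> (Suc (Suc i))))"
  shows "computable_expr n (\<lambda>f \<rho>. case C f \<rho> of 0 \<Rightarrow> A f \<rho> | Suc m \<Rightarrow> B f m \<rho>)"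
proof -
  have eq: "(case c of 0 \<Rightarrow> a | Suc m \<Rightarrow> b m) = rec_nat a (\<lambda>m _. b m) c"
    for a c :: nat and b
    by (cases c) auto
  show ?thesis
    unfolding eq by (intro computable_intros assms)
qed

lemma computable_expr_diff [computable_intros]:
  assumes "computable_expr n A" "computable_expr n B"
  shows "computable_expr n (\<lambda>f \<rho>. A f \<rho> - B f \<rho>)"
proof -
  have eq: "a - b = rec_nat a (\<lambda>_ r. case r of 0 \<Rightarrow> 0 | Suc m \<Rightarrow> m) b" for a b :: nat
    by (induction b) (auto split: nat.split)
  show ?thesis
    unfolding eq by (intro computable_intros computable_expr_case_nat assms) simp_all
qed

text \<open>
  The environment may be replaced by computed values. Besides composition, this covers moving an
  expression below a binder, where its variables have shifted indices.
\<close>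

lemma computable_expr_subst:
  assumes "computable_expr k A" and "\<And>i. i < k \<Longrightarrow> computable_expr n (E i)"
  shows "computable_expr n (\<lambda>f \<rho>. A f (\<lambda>i. E i f \<rho>))"
proof -
  obtain p where p: "\<And>f \<rho>. eval p f (map \<rho> [0..<k]) = Some (A f \<rho>)"
    using assms(1) unfolding computable_expr_def by blast
  have "\<exists>q. \<forall>i<k. \<forall>f \<rho>. eval (q i) f (map \<rho> [0..<n]) = Some (E i f \<rho>)"
    using assms(2) unfolding computable_expr_def by (intro choice) blast
  then obtain q where q: "\<And>i f \<rho>. i < k \<Longrightarrow> eval (q i) f (map \<rho> [0..<n]) = Some (E i f \<rho>)"
    by blast
  have "eval (Comp p (map q [0..<k])) f (map \<rho> [0..<n]) = Some (A f (\<lambda>i. E i f \<rho>))" for f \<rho>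
    by (subst eval_Comp_total[where ys = "map (\<lambda>i. E i f \<rho>) [0..<k]"]) (simp_all add: p q)
  then show ?thesis
    unfolding computable_expr_def by blast
qed

lemma computable_expr_weaken:
  assumes "computable_expr n A"
  shows "computable_expr (Suc n) (\<lambda>f \<rho>. A f (\<lambda>i. \<rho> (Suc i)))"
  using assms by (rule computable_expr_subst) (intro computable_intros, simp)

lemma computable_expr_if [computable_intros]:
  assumes "decidable_expr n P" "computable_expr n A" "computable_expr n B"
  shows "computable_expr n (\<lambda>f \<rho>. if P f \<rho> then A f \<rho> else B f \<rho>)"
proof -
  have eq: "(if P then a else b) = (case of_bool P of 0 \<Rightarrow> b | Suc m \<Rightarrow> a)" for P and a b :: nat
    by simp
  show ?thesis
    unfolding eq
    by (intro computable_expr_case_nat assms computable_expr_weaken[OF computable_expr_weaken])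
qed

lemma decidable_expr_less [computable_intros]:
  assumes "computable_expr n A" "computable_expr n B"
  shows "decidable_expr n (\<lambda>f \<rho>. A f \<rho> < B f \<rho>)"
proof -
  have eq: "of_bool (a < b) = Suc 0 - (Suc a - b)" for a b :: nat
    by simp
  show ?thesis
    unfolding eq by (intro computable_intros assms)
qed

lemma decidable_expr_not [computable_intros]:
  assumes "decidable_expr n P"
  shows "decidable_expr n (\<lambda>f \<rho>. \<not> P f \<rho>)"
proof -
  have eq: "of_bool (\<not> P) = Suc 0 - of_bool P" for P
    by simp
  show ?thesis
    unfolding eq by (intro computable_intros assms)
qed

lemma decidable_expr_conj [computable_intros]:
  assumes "decidable_expr n P" "decidable_expr n Q"
  shows "decidable_expr n (\<lambda>f \<rho>. P f \<rho> \<and> Q f \<rho>)"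
proof -
  have eq: "of_bool (P \<and> Q) = (if P then of_bool Q else (0::nat))" for P Q
    by simp
  show ?thesis
    unfolding eq by (intro computable_intros assms)
qed

lemma decidable_expr_disj [computable_intros]:
  assumes "decidable_expr n P" "decidable_expr n Q"
  shows "decidable_expr n (\<lambda>f \<rho>. P f \<rho> \<or> Q f \<rho>)"
proof -
  have eq: "(P \<or> Q) = (\<not> (\<not> P \<and> \<not> Q))" for P Q
    by simp
  show ?thesis
    unfolding eq by (intro computable_intros assms)
qed

lemma decidable_expr_eq [computable_intros]:
  assumes "computable_expr n A" "computable_expr n B"
  shows "decidable_expr n (\<lambda>f \<rho>. A f \<rho> = B f \<rho>)"
proof -
  have eq: "(a = b) = (\<not> a < b \<and> \<not> b < a)" for a b :: nat
    by auto
  show ?thesis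
    unfolding eq by (intro computable_intros assms)
qed

lemma computable_expr_Least [computable_intros]:
  assumes "decidable_expr (Suc n) (\<lambda>f \<rho>. P f (\<rho> 0) (\<lambda>i. \<rho> (Suc i)))"
    and ex: "\<And>f \<rho>. \<exists>m. P f m \<rho>"
  shows "computable_expr n (\<lambda>f \<rho>. LEAST m. P f m \<rho>)"
proof -
  \<comment> \<open>The operator \<open>Mu\<close> searches for the value \<open>0\<close>, hence the negation.\<close>
  obtain p where "\<And>f \<rho>. eval p f (map \<rho> [0..<Suc n]) =
      Some (of_bool (\<not> P f (\<rho> 0) (\<lambda>i. \<rho> (Suc i))))"
    using decidable_expr_not[OF assms(1)] unfolding computable_expr_def by blast
  then have p: "eval p f (m # map \<rho> [0..<n]) = Some (of_bool (\<not> P f m \<rho>))" for f m \<rho>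
    unfolding map_env_Cons by simp
  have "eval (Mu p) f (map \<rho> [0..<n]) = Some (LEAST m. P f m \<rho>)" for f \<rho>
    using ex[of f \<rho>] by (simp add: p)
  then show ?thesis
    unfolding computable_expr_def by blast
qed

text \<open>
  A bounded quantifier is a minimisation that is certain to stop at the bound, and it is true
  exactly if the search stops earlier.
\<close>

lemma decidable_expr_bex [computable_intros]:
  assumes "computable_expr n N"
    and "decidable_expr (Suc n) (\<lambda>f \<rho>. P f (\<rho> 0) (\<lambda>i. \<rho> (Suc i)))"
  shows "decidable_expr n (\<lambda>f \<rho>. \<exists>t<N f \<rho>. P f t \<rho>)"
proof -
  have eq: "(\<exists>t<k. Q t) = ((LEAST t. t = k \<or> Q t) < k)" for k :: nat and Q
  proof
    assume "\<exists>t<k. Q t"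
    then show "(LEAST t. t = k \<or> Q t) < k"
      by (metis (mono_tags, lifting) Least_le order_le_less_trans)
  next
    assume *: "(LEAST t. t = k \<or> Q t) < k"
    have "(LEAST t. t = k \<or> Q t) = k \<or> Q (LEAST t. t = k \<or> Q t)"
      by (rule LeastI[of _ k]) simp
    with * show "\<exists>t<k. Q t"
      by auto
  qed
  show ?thesis
    unfolding eq
    by (intro computable_intros assms computable_expr_weaken[OF assms(1)]) auto
qed

section \<open>Codes of pairs and lists\<close>

lemma computable_expr_triangle [computable_intros]:
  assumes "computable_expr n A"
  shows "computable_expr n (\<lambda>f \<rho>. triangle (A f \<rho>))"
proof -
  have eq: "triangle k = rec_nat 0 (\<lambda>m r. r + Suc m) k" for k
    by (induction k) auto
  show ?thesis
    unfolding eq by (intro computable_intros assms) simp_all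
qed

lemma computable_expr_prod_encode [computable_intros]:
  assumes "computable_expr n A" "computable_expr n B"
  shows "computable_expr n (\<lambda>f \<rho>. prod_encode (A f \<rho>, B f \<rho>))"
  unfolding prod_encode_def prod.case by (intro computable_intros assms)

text \<open>
  The pairs coded by numbers from \<open>triangle d\<close> up to but not including \<open>triangle (Suc d)\<close> are
  those with sum \<open>d\<close>, so decoding amounts to a search for \<open>d\<close>.
\<close>

definition diagonal :: "nat \<Rightarrow> nat" where
  "diagonal c = (LEAST d. c < triangle (Suc d))"

lemma diagonal_prod_encode: "diagonal (prod_encode (a, b)) = a + b"
  unfolding diagonal_def
proof (rule Least_equality)
  show "prod_encode (a, b) < triangle (Suc (a + b))"
    by (simp add: prod_encode_def)
next
  fix d
  assume less: "prod_encode (a, b) < triangle (Suc d)"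
  have mono: "mono triangle"
    by (simp add: mono_iff_le_Suc)
  show "a + b \<le> d"
  proof (rule ccontr)
    assume "\<not> a + b \<le> d"
    then have "triangle (Suc d) \<le> triangle (a + b)"
      by (intro monoD[OF mono]) simp
    with less show False
      by (simp add: prod_encode_def)
  qed
qed

lemma prod_decode_eq_diagonal:
  "fst (prod_decode c) = c - triangle (diagonal c)"
  "snd (prod_decode c) = diagonal c - (c - triangle (diagonal c))"
proof -
  obtain a b where "c = prod_encode (a, b)"
    by (metis prod_decode_inverse surj_pair)
  then show "fst (prod_decode c) = c - triangle (diagonal c)"
    "snd (prod_decode c) = diagonal c - (c - triangle (diagonal c))"
    by (simp_all add: diagonal_prod_encode) (simp_all add: prod_encode_def)
qed

lemma computable_expr_diagonal [computable_intros]: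
  assumes "computable_expr n A"
  shows "computable_expr n (\<lambda>f \<rho>. diagonal (A f \<rho>))"
proof -
  have "\<exists>d. c < triangle (Suc d)" for c
    by (rule exI[of _ c]) simp
  then show ?thesis
    unfolding diagonal_def
    by (intro computable_intros computable_expr_weaken[OF assms]) simp_all
qed

lemma computable_expr_prod_decode [computable_intros]:
  assumes "computable_expr n A"
  shows "computable_expr n (\<lambda>f \<rho>. fst (prod_decode (A f \<rho>)))"
    and "computable_expr n (\<lambda>f \<rho>. snd (prod_decode (A f \<rho>)))"
  unfolding prod_decode_eq_diagonal by (intro computable_intros assms)+

text \<open>
  The code of a list is built from that of its tail by primitive recursion, so the entries are
  computed from the last one down.
\<close>

lemma computable_expr_list_encode_map [computable_intros]:
  assumes "computable_expr n N"
    and "computable_expr (Suc n) (\<lambda>f \<rho>. G f (\<rho> 0) (\<lambda>i. \<rho> (Suc i)))"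
  shows "computable_expr n (\<lambda>f \<rho>. list_encode (map (\<lambda>i. G f i \<rho>) [0..<N f \<rho>]))"
proof -
  have upto: "rec_nat 0 (\<lambda>j r. Suc (prod_encode (g (k - Suc j), r))) j =
      list_encode (map g [k - j..<k])" if "j \<le> k" for g :: "nat \<Rightarrow> nat" and j k
    using that
  proof (induction j)
    case (Suc j)
    then have "[k - Suc j..<k] = (k - Suc j) # [k - j..<k]"
      by (simp add: upt_conv_Cons Suc_diff_Suc)
    with Suc show ?case
      by simp
  qed simp
  have eq: "list_encode (map g [0..<k]) =
      rec_nat 0 (\<lambda>j r. Suc (prod_encode (g (k - Suc j), r))) k" for g :: "nat \<Rightarrow> nat" and k
    using upto[of k k g] by simp
  have entry: "computable_expr (Suc (Suc n)) (\<lambda>f \<rho>.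
      G f (N f (\<lambda>i. \<rho> (Suc (Suc i))) - Suc (\<rho> 0)) (\<lambda>i. \<rho> (Suc (Suc i))))"
  proof -
    \<comment> \<open>Of the two variables bound by the recursion, the entry depends on the counter only,
      through its index; the previous value \<open>\<rho> (Suc 0)\<close> is skipped.\<close>
    define E where "E i f \<rho> = (case i of
        0 \<Rightarrow> N f (\<lambda>i. \<rho> (Suc (Suc i))) - Suc (\<rho> 0) | Suc j \<Rightarrow> \<rho> (Suc (Suc j)))"
      for i and f \<rho> :: "nat \<Rightarrow> nat"
    have "computable_expr (Suc (Suc n)) (E i)" if "i < Suc n" for i
      using that unfolding E_def
      by (cases i) (auto intro!: computable_intros
          computable_expr_weaken[OF computable_expr_weaken[OF assms(1)]])
    from computable_expr_subst[where E = E, OF assms(2) this] show ?thesis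
      by (simp add: E_def)
  qed
  show ?thesis
    unfolding eq by (intro computable_intros assms(1) entry) simp
qed

section \<open>Reductions given by expressions\<close>

lemma weihrauch_leI:
  assumes "computable_expr (Suc 0) (\<lambda>I \<rho>. \<Phi> I (\<rho> 0))"
    and "computable_expr (Suc 0) (\<lambda>I \<rho>. \<Psi> I (\<rho> 0))"
    and "\<And>I. I \<in> Domain P \<Longrightarrow> \<Phi> I \<in> Domain Q"
    and "\<And>I S. I \<in> Domain P \<Longrightarrow> (\<Phi> I, S) \<in> Q \<Longrightarrow> (I, \<Psi> I S) \<in> P"
  shows "P \<le>\<^sub>W Q"
proof -
  have unary: "\<exists>p. \<forall>I x. eval p I [x] = Some (A I x)"
    if "computable_expr (Suc 0) (\<lambda>I \<rho>. A I (\<rho> 0))" for A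
    using that unfolding computable_expr_def by (auto dest: spec[of _ "\<lambda>_. x" for x])
  obtain p where "\<And>I x. eval p I [x] = Some (\<Phi> I x)"
    using unary[OF assms(1)] by blast
  then have "computable_operator (\<lambda>I. Some (\<Phi> I))"
    unfolding computable_operator_def by (intro exI[of _ p]) (simp add: fun_eq_iff)
  moreover have "computable_functional (\<lambda>I S. Some (\<Psi> I S))"
    using unary[OF assms(2)] unfolding computable_functional_def by metis
  ultimately show ?thesis
    unfolding weihrauch_le_def using assms(3,4) by blast
qed

section \<open>Solutions of the problems\<close>

lemma in_Domain_parallel_star:
  assumes "\<And>i. i < head I \<Longrightarrow> component I i \<in> Domain P"
  shows "I \<in> Domain (P\<^sup>\<star>)"
proof -
  have "\<exists>S. \<forall>i<head I. (component I i, S i) \<in> P"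
    using assms by (intro choice) blast
  then obtain S where "\<forall>i<head I. (component I i, S i) \<in> P" ..
  then have "(I, list_encode (map S [0..<head I])) \<in> P\<^sup>\<star>"
    unfolding parallel_star_def by (auto intro!: exI[of _ "map S [0..<head I]"])
  then show ?thesis ..
qed

text \<open>
  Every enumeration is an instance: if nothing is left out, any number is a solution.
\<close>

lemma in_Domain_TC_N: "e \<in> Domain TC_N"
  unfolding TC_N_def by blast

text \<open>
  From \<open>b\<close> on, a colour that has a next occurrence after each of its occurrences has infinitely
  many. In this form the condition on \<open>x\<close> depends only on the colour of \<open>x\<close>.
\<close>

lemma ECT_iff_infinite:
  "(I, b) \<in> ECT \<longleftrightarrow> (\<forall>x. tail I x < head I) \<and> (\<forall>x\<ge>b. infinite {y. tail I y = tail I x})"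
proof -
  have "infinite {y. tail I y = tail I x}"
    if rec: "\<forall>x\<ge>b. \<exists>y>x. tail I x = tail I y" and "x \<ge> b" for x
  proof
    assume fin: "finite {y. tail I y = tail I x}"
    define m where "m = Max {y. tail I y = tail I x}"
    have "m \<in> {y. tail I y = tail I x}"
      unfolding m_def using fin by (intro Max_in) auto
    moreover have "x \<le> m"
      unfolding m_def using fin by (intro Max_ge) auto
    ultimately obtain y where "y > m" "tail I y = tail I x"
      using rec \<open>x \<ge> b\<close> by (metis (mono_tags) mem_Collect_eq order_trans)
    then show False
      using Max_ge[OF fin, of y] by (simp add: m_def)
  qed
  moreover have "\<exists>y>x. tail I x = tail I y" if "infinite {y. tail I y = tail I x}" for x
    using that unfolding infinite_nat_iff_unbounded by (metis mem_Collect_eq)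
  ultimately show ?thesis
    unfolding ECT_def by blast
qed

lemma in_Domain_ECT:
  assumes "\<And>x. tail I x < head I"
  shows "I \<in> Domain ECT"
proof -
  \<comment> \<open>There are finitely many colours, so only finitely many places have a colour that occurs
    finitely often.\<close>
  define F where "F = {x. finite {y. tail I y = tail I x}}"
  have "F \<subseteq> (\<Union>c\<in>{c. c < head I \<and> finite {y. tail I y = c}}. {y. tail I y = c})"
    unfolding F_def using assms by auto
  then have "finite F"
    by (rule finite_subset) auto
  then obtain b where "\<forall>x\<in>F. x < b"
    using finite_nat_set_iff_bounded by blast
  then have "(I, b) \<in> ECT"
    unfolding ECT_iff_infinite F_def using assms by (auto simp: not_less[symmetric])
  then show ?thesis ..
qed

section \<open>Bounding the finitely recurring colours\<close>

text \<open>
  The \<open>i\<close>-th component enumerates the numbers that have an occurrence of colour \<open>i\<close> at or above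
  them. A step \<open>\<langle>b, d\<rangle>\<close> of the enumeration inspects the place \<open>b + d\<close>.
\<close>

definition occurrence_instances :: "(nat \<Rightarrow> nat) \<Rightarrow> nat \<Rightarrow> nat" where
  "occurrence_instances I x =
     (if x = 0 then I 0
      else let i = fst (prod_decode (x - 1)); s = snd (prod_decode (x - 1));
               b = fst (prod_decode s); d = snd (prod_decode s)
           in if I (Suc (b + d)) = i then Suc b else 0)"

lemma enumerated_occurrence_instances:
  "enumerated (component (occurrence_instances I) i) = {b. \<exists>x\<ge>b. tail I x = i}"
proof -
  have "(\<exists>s. component (occurrence_instances I) i s = Suc b) \<longleftrightarrow> (\<exists>x\<ge>b. tail I x = i)" for b
  proof
    assume "\<exists>s. component (occurrence_instances I) i s = Suc b"
    then obtain s where "b = fst (prod_decode s)"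
      and "tail I (fst (prod_decode s) + snd (prod_decode s)) = i"
      by (auto simp: component_def tail_def occurrence_instances_def Let_def split: if_splits)
    then show "\<exists>x\<ge>b. tail I x = i"
      using le_add1 by blast
  next
    assume "\<exists>x\<ge>b. tail I x = i"
    then obtain d where "tail I (b + d) = i"
      by (metis le_Suc_ex)
    then have "component (occurrence_instances I) i (prod_encode (b, d)) = Suc b"
      by (simp add: component_def tail_def occurrence_instances_def)
    then show "\<exists>s. component (occurrence_instances I) i s = Suc b" ..
  qed
  then show ?thesis
    by (simp add: enumerated_def)
qed

lemma nth_le_list_encode: "i < length xs \<Longrightarrow> xs ! i \<le> list_encode xs"
proof (induction xs arbitrary: i)
  case (Cons x xs)
  have "x \<le> prod_encode (x, list_encode xs)" "list_encode xs \<le> prod_encode (x, list_encode xs)"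
    by (rule le_prod_encode_1, rule le_prod_encode_2)
  with Cons show ?case
    by (cases i) (auto intro: le_SucI order_trans)
qed simp

lemma ECT_le_TC_N_star: "ECT \<le>\<^sub>W TC_N\<^sup>\<star>"
proof (rule weihrauch_leI[where \<Phi> = occurrence_instances and \<Psi> = "\<lambda>I S. S"])
  show "computable_expr (Suc 0) (\<lambda>I \<rho>. occurrence_instances I (\<rho> 0))"
    unfolding occurrence_instances_def Let_def One_nat_def by (intro computable_intros) simp_all
  show "computable_expr (Suc 0) (\<lambda>I \<rho>. \<rho> 0)"
    by (intro computable_intros) simp
next
  fix I
  show "occurrence_instances I \<in> Domain (TC_N\<^sup>\<star>)"
    by (intro in_Domain_parallel_star in_Domain_TC_N)
next
  fix I S
  assume "I \<in> Domain ECT" and sol: "(occurrence_instances I, S) \<in> TC_N\<^sup>\<star>"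
  then have colours: "tail I x < head I" for x
    by (auto simp: ECT_def)
  have [simp]: "head (occurrence_instances I) = head I"
    by (simp add: head_def occurrence_instances_def)
  obtain bs where S: "S = list_encode bs" and len: "length bs = head I"
    and bs: "\<And>i. i < head I \<Longrightarrow> (component (occurrence_instances I) i, bs ! i) \<in> TC_N"
    using sol unfolding parallel_star_def by auto
  have "infinite {y. tail I y = tail I x}" if "x \<ge> S" for x
  proof
    assume "finite {y. tail I y = tail I x}"
    then obtain b where "\<forall>y\<in>{y. tail I y = tail I x}. y < b"
      using finite_nat_set_iff_bounded by blast
    then have "b \<in> - enumerated (component (occurrence_instances I) (tail I x))"
      unfolding enumerated_occurrence_instances by force
    then have "bs ! tail I x \<notin> enumerated (component (occurrence_instances I) (tail I x))"
      using bs[OF colours] unfolding TC_N_def by blast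
    moreover have "bs ! tail I x \<le> x"
      using nth_le_list_encode[of "tail I x" bs] colours len S that by (simp add: order_trans)
    ultimately show False
      unfolding enumerated_occurrence_instances by blast
  qed
  then show "(I, S) \<in> ECT"
    unfolding ECT_iff_infinite using colours by blast
qed

section \<open>Guessing the least number that is not enumerated\<close>

definition first_gap :: "(nat \<Rightarrow> nat) \<Rightarrow> nat \<Rightarrow> nat" where
  "first_gap e s = (LEAST m. \<not> (\<exists>t<s. e t = Suc m))"

lemma gap_exists: "\<exists>m. \<not> (\<exists>t<s. e t = Suc m)" for e :: "nat \<Rightarrow> nat"
proof (intro exI notI)
  assume "\<exists>t<s. e t = Suc (sum e {..<s})"
  then obtain t where "t < s" "e t = Suc (sum e {..<s})"
    by blast
  moreover have "e t \<le> sum e {..<s}"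
    using \<open>t < s\<close> by (intro member_le_sum) auto
  ultimately show False
    by simp
qed

lemma first_gap_not_enumerated_before: "t < s \<Longrightarrow> e t \<noteq> Suc (first_gap e s)"
  using LeastI_ex[OF gap_exists[of s e]] unfolding first_gap_def by blast

lemma enumerated_before_if_less_first_gap: "m < first_gap e s \<Longrightarrow> \<exists>t<s. e t = Suc m"
  using not_less_Least[of m] unfolding first_gap_def by blast

definition refuted_at :: "(nat \<Rightarrow> nat) \<Rightarrow> nat \<Rightarrow> bool" where
  "refuted_at e s \<longleftrightarrow> e s = Suc (first_gap e s)"

text \<open>
  Refutations are finite in number: a guess is refuted at most once, because it is never made again, and no guess exceeds an
  element \<open>a\<close> of the complement.
\<close>

lemma finite_refuted_at:
  assumes "a \<in> - enumerated e"
  shows "finite {s. refuted_at e s}"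
proof (rule finite_imageD)
  have "first_gap e s \<le> a" for s
    using assms enumerated_before_if_less_first_gap[of a e s]
    by (auto simp: enumerated_def not_le[symmetric])
  then have "first_gap e ` {s. refuted_at e s} \<subseteq> {..a}"
    by auto
  then show "finite (first_gap e ` {s. refuted_at e s})"
    by (rule finite_subset) simp
  show "inj_on (first_gap e) {s. refuted_at e s}"
    unfolding refuted_at_def
    by (rule linorder_inj_onI') (auto dest: first_gap_not_enumerated_before)
qed

lemma first_gap_not_enumerated:
  assumes "\<And>s. s \<ge> b \<Longrightarrow> \<not> refuted_at e s"
  shows "first_gap e b \<notin> enumerated e"
proof
  assume "first_gap e b \<in> enumerated e"
  then have ex: "\<exists>t. e t = Suc (first_gap e b)"
    by (simp add: enumerated_def)
  \<comment> \<open>The guess is unchanged until the first stage that enumerates it.\<close>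
  define t where "t = (LEAST t. e t = Suc (first_gap e b))"
  have t: "e t = Suc (first_gap e b)"
    unfolding t_def by (rule LeastI_ex[OF ex])
  have "t \<ge> b"
    using t first_gap_not_enumerated_before[of t b e] by (meson not_le)
  have "first_gap e t = first_gap e b"
    unfolding first_gap_def[of e t]
  proof (rule Least_equality)
    show "\<not> (\<exists>u<t. e u = Suc (first_gap e b))"
      unfolding t_def using not_less_Least by blast
  next
    fix m
    assume "\<not> (\<exists>u<t. e u = Suc m)"
    then show "first_gap e b \<le> m"
      using enumerated_before_if_less_first_gap[of m e b] \<open>t \<ge> b\<close> by (meson not_le less_le_trans)
  qed
  then have "refuted_at e t"
    using t by (simp add: refuted_at_def)
  with assms \<open>t \<ge> b\<close> show False
    by blast
qed

definition refutation_colouring :: "(nat \<Rightarrow> nat) \<Rightarrow> nat \<Rightarrow> nat" where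
  "refutation_colouring I x =
     (if x = 0 then Suc (I 0)
      else let i = fst (prod_decode (x - 1)); s = snd (prod_decode (x - 1))
           in if i < I 0 \<and> refuted_at (component I i) s then Suc i else 0)"

lemma head_refutation_colouring: "head (refutation_colouring I) = Suc (head I)"
  by (simp add: head_def refutation_colouring_def)

lemma tail_refutation_colouring:
  "tail (refutation_colouring I) (prod_encode (i, s)) =
     (if i < head I \<and> refuted_at (component I i) s then Suc i else 0)"
  by (simp add: head_def tail_def refutation_colouring_def)

lemma tail_refutation_colouring_less: "tail (refutation_colouring I) x < Suc (head I)"
  by (simp add: head_def tail_def refutation_colouring_def Let_def)

lemma computable_expr_component [computable_intros]:
  assumes "computable_expr n A" "computable_expr n B"
  shows "computable_expr n (\<lambda>f \<rho>. component f (A f \<rho>) (B f \<rho>))"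
  unfolding component_def tail_def by (intro computable_intros assms)

lemma computable_expr_first_gap [computable_intros]:
  assumes "computable_expr n A" "computable_expr n B"
  shows "computable_expr n (\<lambda>f \<rho>. first_gap (component f (A f \<rho>)) (B f \<rho>))"
  unfolding first_gap_def
  by (intro computable_intros gap_exists assms[THEN computable_expr_weaken]
      assms[THEN computable_expr_weaken, THEN computable_expr_weaken]) simp_all

lemma TC_N_star_le_ECT: "TC_N\<^sup>\<star> \<le>\<^sub>W ECT"
proof (rule weihrauch_leI[where \<Phi> = refutation_colouring
      and \<Psi> = "\<lambda>I b. list_encode (map (\<lambda>i. first_gap (component I i) b) [0..<I 0])"])
  show "computable_expr (Suc 0) (\<lambda>I \<rho>. refutation_colouring I (\<rho> 0))"
    unfolding refutation_colouring_def refuted_at_def Let_def One_nat_def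
    by (intro computable_intros) simp_all
  show "computable_expr (Suc 0)
      (\<lambda>I \<rho>. list_encode (map (\<lambda>i. first_gap (component I i) (\<rho> 0)) [0..<I 0]))"
    by (intro computable_intros) simp_all
next
  fix I
  show "refutation_colouring I \<in> Domain ECT"
    by (rule in_Domain_ECT)
      (simp add: head_refutation_colouring tail_refutation_colouring_less)
next
  fix I b
  assume "(refutation_colouring I, b) \<in> ECT"
  then have recurring: "infinite {y. tail (refutation_colouring I) y = tail (refutation_colouring I) x}"
    if "x \<ge> b" for x
    unfolding ECT_iff_infinite using that by blast
  have "(component I i, first_gap (component I i) b) \<in> TC_N" if i: "i < head I" for i
  proof -
    have "first_gap (component I i) b \<notin> enumerated (component I i)"
      if a: "a \<in> - enumerated (component I i)" for a
    proof (rule first_gap_not_enumerated)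
      fix s
      assume "s \<ge> b"
      then have "prod_encode (i, s) \<ge> b"
        by (meson le_prod_encode_2 order_trans)
      \<comment> \<open>A refutation at stage \<open>s\<close> would make the colour \<open>Suc i\<close> recur forever, but the guess
        is refuted only finitely often.\<close>
      note inf = recurring[OF this]
      show "\<not> refuted_at (component I i) s"
      proof
        assume "refuted_at (component I i) s"
        with i have colour: "tail (refutation_colouring I) (prod_encode (i, s)) = Suc i"
          by (simp add: tail_refutation_colouring)
        have "{y. tail (refutation_colouring I) y = Suc i}
            \<subseteq> (\<lambda>s. prod_encode (i, s)) ` {s. refuted_at (component I i) s}"
        proof
          fix y
          assume y: "y \<in> {y. tail (refutation_colouring I) y = Suc i}"
          obtain j t where "y = prod_encode (j, t)"
            by (metis prod_decode_inverse surj_pair)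
          with y show "y \<in> (\<lambda>s. prod_encode (i, s)) ` {s. refuted_at (component I i) s}"
            by (auto simp: tail_refutation_colouring split: if_splits)
        qed
        with finite_refuted_at[OF a] inf colour show False
          by (metis finite_imageI finite_subset)
      qed
    qed
    then show ?thesis
      unfolding TC_N_def by blast
  qed
  then show "(I, list_encode (map (\<lambda>i. first_gap (component I i) b) [0..<I 0])) \<in> TC_N\<^sup>\<star>"
    unfolding parallel_star_def head_def
    by (auto intro!: exI[of _ "map (\<lambda>i. first_gap (component I i) b) [0..<I 0]"])
qed

theorem theorem9: "ECT \<equiv>\<^sub>W TC_N\<^sup>\<star>"
  unfolding weihrauch_equiv_def using ECT_le_TC_N_star TC_N_star_le_ECT by blast

end
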